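(* Let $S$ be a semiring. (1) If $I$ is a $k$-strongly irreducible ideal of $S$, then $I$ is a $k$-prime ideal of $S$ if and only if $I=\mathcal{R}_k(I)$. (2) If $S$ is Laskerian, then every $k$-strongly irreducible ideal of $S$ is $k$-primary. (3) If $S$ is von Neumann regular, then an ideal of $S$ is $k$-strongly irreducible if and only if it is $k$-primary.
   Context: A semiring is a commutative semiring $(S,+,0,\cdot,1)$ with multiplicative identity $1$ and additive identity $0$ that is absorbing. An ideal is a nonempty subset closed under addition and under multiplication by elements of $S$. A $k$-ideal is an ideal $I$ such that $x+y\in I$ and $y\in I$ imply $x\in I$. A $k$-ideal $I$ is: $k$-strongly irreducible if for all $k$-ideals $A,B$, $A\cap B\subseteq I$ implies $A\subseteq I$ or $B\subseteq I$; $k$-prime if for all $k$-ideals $A,B$, $AB\subseteq I$ implies $A\subseteq I$ or $B\subseteq I$ ($AB$ is the ideal of finite sums of products $ab$, $a\in A$, $b\in B$); $k$-primary if $ab\in I$ and $a\notin I$ imply $b^n\in I$ for some natural number $n\ge1$. The $k$-radical $\mathcal{R}_k(I)$ is the intersection of all $k$-prime ideals of $S$ containing $I$. $S$ is Laskerian if every $k$-ideal has a $k$-primary decomposition, i.e. is a finite intersection $\bigcap_{i=1}^n A_i$ of $k$-primary ideals. $S$ is von Neumann regular if for every $a\in S$ there is $x\in S$ with $a=a^2x$. *)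

theory Defs
  imports "HOL-Algebra.Ideal_Product"
begin

text \<open>
  HOL-Algebra's \<^emph>\<open>ideal\<close> presupposes a ring (in particular additive inverses), so the
  semiring notions are defined here. All predicates are meant for a commutative semiring \<open>S\<close>, i.e.
  \<open>semiring S\<close> together with \<open>comm_monoid S\<close>; as in \<open>semiring\<close>, \<open>\<zero> = \<one>\<close> is not excluded.
  No class of ideals below is required to be proper; in particular, \<open>carrier S\<close> is \<open>k\<close>-prime,
  \<open>k\<close>-primary and \<open>k\<close>-strongly irreducible.
\<close>

definition semiring_ideal :: "('a, 'b) ring_scheme \<Rightarrow> 'a set \<Rightarrow> bool" where
  "semiring_ideal S I \<longleftrightarrow>
     I \<subseteq> carrier S \<and> I \<noteq> {} \<and>
     (\<forall>x\<in>I. \<forall>y\<in>I. x \<oplus>\<^bsub>S\<^esub> y \<in> I) \<and>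
     (\<forall>s\<in>carrier S. \<forall>x\<in>I. s \<otimes>\<^bsub>S\<^esub> x \<in> I)"

definition k_ideal :: "('a, 'b) ring_scheme \<Rightarrow> 'a set \<Rightarrow> bool" where
  "k_ideal S I \<longleftrightarrow>
     semiring_ideal S I \<and>
     (\<forall>x\<in>carrier S. \<forall>y\<in>carrier S. x \<oplus>\<^bsub>S\<^esub> y \<in> I \<and> y \<in> I \<longrightarrow> x \<in> I)"

definition k_strongly_irreducible :: "('a, 'b) ring_scheme \<Rightarrow> 'a set \<Rightarrow> bool" where
  "k_strongly_irreducible S I \<longleftrightarrow>
     k_ideal S I \<and>
     (\<forall>A B. k_ideal S A \<and> k_ideal S B \<and> A \<inter> B \<subseteq> I \<longrightarrow> A \<subseteq> I \<or> B \<subseteq> I)"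

text \<open>
  The library's \<open>ideal_prod S A B\<close> is the closure under addition of the set of products
  of an element of \<open>A\<close> and one of \<open>B\<close>, i.e. the set of finite nonempty sums of such products.
\<close>

definition k_prime :: "('a, 'b) ring_scheme \<Rightarrow> 'a set \<Rightarrow> bool" where
  "k_prime S I \<longleftrightarrow>
     k_ideal S I \<and>
     (\<forall>A B. k_ideal S A \<and> k_ideal S B \<and> ideal_prod S A B \<subseteq> I \<longrightarrow> A \<subseteq> I \<or> B \<subseteq> I)"

definition k_primary :: "('a, 'b) ring_scheme \<Rightarrow> 'a set \<Rightarrow> bool" where
  "k_primary S I \<longleftrightarrow>
     k_ideal S I \<and>
     (\<forall>a\<in>carrier S. \<forall>b\<in>carrier S. a \<otimes>\<^bsub>S\<^esub> b \<in> I \<and> a \<notin> I \<longrightarrow>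
        (\<exists>n::nat. n \<ge> 1 \<and> b [^]\<^bsub>S\<^esub> n \<in> I))"

text \<open>The family intersected is never empty, since it contains \<open>carrier S\<close>.\<close>

definition k_radical :: "('a, 'b) ring_scheme \<Rightarrow> 'a set \<Rightarrow> 'a set" where
  "k_radical S I = \<Inter>{P. k_prime S P \<and> I \<subseteq> P}"

definition laskerian :: "('a, 'b) ring_scheme \<Rightarrow> bool" where
  "laskerian S \<longleftrightarrow>
     (\<forall>I. k_ideal S I \<longrightarrow>
        (\<exists>(n::nat) A. n \<ge> 1 \<and> (\<forall>i\<in>{1..n}. k_primary S (A i)) \<and> I = (\<Inter>i\<in>{1..n}. A i)))"

definition von_neumann_regular :: "('a, 'b) ring_scheme \<Rightarrow> bool" where
  "von_neumann_regular S \<longleftrightarrow>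
     (\<forall>a\<in>carrier S. \<exists>x\<in>carrier S. a = a [^]\<^bsub>S\<^esub> (2::nat) \<otimes>\<^bsub>S\<^esub> x)"

end

theory Submission
  imports Defs
begin

text \<open>
  All three parts test strong irreducibility on a suitable pair of \<open>k\<close>-ideals. In (1), a
  \<open>k\<close>-prime ideal that contains \<open>AB\<close> contains \<open>A\<close> or \<open>B\<close> and hence \<open>A \<inter> B\<close>. In (2), a strongly
  irreducible finite intersection of \<open>k\<close>-ideals is one of them. In (3), if \<open>ab \<in> I\<close>, then
  \<open>A = (I : b)\<close> and \<open>B = (I : A)\<close> are \<open>k\<close>-ideals that contain \<open>a\<close> and \<open>b\<close> respectively, and
  \<open>x \<in> A \<inter> B\<close> gives \<open>x\<^sup>2 \<in> I\<close>, whence \<open>x \<in> I\<close> by regularity; conversely, regularity turns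
  \<open>b\<^sup>n \<in> I\<close> into \<open>b \<in> I\<close>.
\<close>

lemma k_ideal_subset_carrier: "k_ideal S I \<Longrightarrow> I \<subseteq> carrier S"
  by (simp add: k_ideal_def semiring_ideal_def)

lemma k_ideal_mult_left:
  "\<lbrakk>k_ideal S I; s \<in> carrier S; x \<in> I\<rbrakk> \<Longrightarrow> s \<otimes>\<^bsub>S\<^esub> x \<in> I"
  by (simp add: k_ideal_def semiring_ideal_def)

lemma k_ideal_add: "\<lbrakk>k_ideal S I; x \<in> I; y \<in> I\<rbrakk> \<Longrightarrow> x \<oplus>\<^bsub>S\<^esub> y \<in> I"
  by (simp add: k_ideal_def semiring_ideal_def)

lemma k_ideal_cancel:
  "\<lbrakk>k_ideal S I; x \<in> carrier S; y \<in> carrier S; x \<oplus>\<^bsub>S\<^esub> y \<in> I; y \<in> I\<rbrakk> \<Longrightarrow> x \<in> I"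
  by (auto simp: k_ideal_def)

lemma k_ideal_mult_right:
  assumes "comm_monoid S" "k_ideal S I" "s \<in> carrier S" "x \<in> I"
  shows "x \<otimes>\<^bsub>S\<^esub> s \<in> I"
  using k_ideal_mult_left[OF assms(2-4)] comm_monoid.m_comm[OF assms(1,3)]
    subsetD[OF k_ideal_subset_carrier[OF assms(2)] assms(4)]
  by simp

text \<open>An ideal is only required to be nonempty, but absorption applied to the scalar 0 and any
  member yields 0. This supplies the nonemptiness of intersections and residuals.\<close>

lemma k_ideal_zero:
  assumes "semiring S" "k_ideal S I"
  shows "\<zero>\<^bsub>S\<^esub> \<in> I"
proof -
  interpret semiring S by fact
  obtain x where "x \<in> I"
    using assms(2) by (auto simp: k_ideal_def semiring_ideal_def)
  moreover have "x \<in> carrier S"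
    using \<open>x \<in> I\<close> assms(2) k_ideal_subset_carrier by blast
  ultimately show ?thesis
    using k_ideal_mult_left[OF assms(2) zero_closed] by fastforce
qed

lemma k_ideal_INT:
  assumes "semiring S" "J \<noteq> {}" "\<And>i. i \<in> J \<Longrightarrow> k_ideal S (A i)"
  shows "k_ideal S (\<Inter>i\<in>J. A i)"
  unfolding k_ideal_def semiring_ideal_def
proof (intro conjI ballI impI)
  show "(\<Inter>i\<in>J. A i) \<subseteq> carrier S"
    using assms(2,3) k_ideal_subset_carrier by blast
  show "(\<Inter>i\<in>J. A i) \<noteq> {}"
    using k_ideal_zero[OF assms(1,3)] by blast
next
  fix x y assume "x \<in> (\<Inter>i\<in>J. A i)" "y \<in> (\<Inter>i\<in>J. A i)"
  then show "x \<oplus>\<^bsub>S\<^esub> y \<in> (\<Inter>i\<in>J. A i)"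
    using k_ideal_add[OF assms(3)] by simp
next
  fix s x assume "s \<in> carrier S" "x \<in> (\<Inter>i\<in>J. A i)"
  then show "s \<otimes>\<^bsub>S\<^esub> x \<in> (\<Inter>i\<in>J. A i)"
    using k_ideal_mult_left[OF assms(3)] by simp
next
  fix x y assume "x \<in> carrier S" "y \<in> carrier S"
    "x \<oplus>\<^bsub>S\<^esub> y \<in> (\<Inter>i\<in>J. A i) \<and> y \<in> (\<Inter>i\<in>J. A i)"
  then show "x \<in> (\<Inter>i\<in>J. A i)"
    using k_ideal_cancel[OF assms(3)] by simp
qed

text \<open>This is the residual \<open>(I : X)\<close>. Distributivity turns a sum in the residual
  into a sum in \<open>I\<close> for each \<open>x\<close> in \<open>X\<close>, so cancellation is
  inherited from \<open>I\<close>.\<close>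

lemma k_ideal_residual:
  assumes "semiring S" "k_ideal S I" "X \<subseteq> carrier S"
  shows "k_ideal S {y \<in> carrier S. \<forall>x\<in>X. y \<otimes>\<^bsub>S\<^esub> x \<in> I}" (is "k_ideal S ?R")
proof -
  interpret semiring S by fact
  note X = subsetD[OF assms(3)]
  show ?thesis
    unfolding k_ideal_def semiring_ideal_def
  proof (intro conjI ballI impI)
    have "\<zero>\<^bsub>S\<^esub> \<in> ?R"
      using k_ideal_zero[OF assms(1,2)] X by simp
    then show "?R \<noteq> {}" by blast
  next
    fix y z assume "y \<in> ?R" "z \<in> ?R"
    then show "y \<oplus>\<^bsub>S\<^esub> z \<in> ?R"
      using X k_ideal_add[OF assms(2)] by (simp add: l_distr)
  next
    fix s y assume "s \<in> carrier S" "y \<in> ?R"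
    then show "s \<otimes>\<^bsub>S\<^esub> y \<in> ?R"
      using X k_ideal_mult_left[OF assms(2)] by (simp add: m_assoc)
  next
    fix y z assume yz: "y \<in> carrier S" "z \<in> carrier S" "y \<oplus>\<^bsub>S\<^esub> z \<in> ?R \<and> z \<in> ?R"
    have "y \<otimes>\<^bsub>S\<^esub> x \<in> I" if "x \<in> X" for x
      using k_ideal_cancel[OF assms(2), of "y \<otimes>\<^bsub>S\<^esub> x" "z \<otimes>\<^bsub>S\<^esub> x"] yz that X[OF that]
      by (auto simp: l_distr)
    then show "y \<in> ?R" using yz(1) by simp
  qed blast
qed

text \<open>\<open>I\<close> is itself a member of the family being intersected.\<close>

lemma k_prime_imp_eq_k_radical: "k_prime S I \<Longrightarrow> I = k_radical S I"
  by (auto simp: k_radical_def)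

lemma k_prime_if_eq_k_radical:
  assumes I: "k_strongly_irreducible S I" and rad: "I = k_radical S I"
  shows "k_prime S I"
  unfolding k_prime_def
proof (intro conjI allI impI)
  show "k_ideal S I" using I by (simp add: k_strongly_irreducible_def)
  fix A B assume AB: "k_ideal S A \<and> k_ideal S B \<and> ideal_prod S A B \<subseteq> I"
  \<comment> \<open>Which of \<open>A\<close> and \<open>B\<close> lies in \<open>P\<close> may
    change with \<open>P\<close>; their intersection lies in every such \<open>P\<close>, hence in
    the radical.\<close>
  have "A \<inter> B \<subseteq> P" if "k_prime S P" "I \<subseteq> P" for P
  proof -
    have "A \<subseteq> P \<or> B \<subseteq> P"
      using AB that unfolding k_prime_def by (meson subset_trans)
    then show ?thesis by blast
  qed
  then have "A \<inter> B \<subseteq> k_radical S I"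
    unfolding k_radical_def by blast
  then have "A \<inter> B \<subseteq> I" using rad by simp
  then show "A \<subseteq> I \<or> B \<subseteq> I"
    using AB I by (simp add: k_strongly_irreducible_def)
qed

text \<open>Induction splits off one index \<open>j\<close> at a time: the binary condition is
  applied to \<open>A j\<close> and the intersection of the rest. The induction starts from
  singletons, so that the rest is a nonempty intersection and hence a
  \<open>k\<close>-ideal.\<close>

lemma k_strongly_irreducible_finite_INT:
  assumes "semiring S" and I: "k_strongly_irreducible S I"
    and "finite J" "J \<noteq> {}" "\<And>i. i \<in> J \<Longrightarrow> k_ideal S (A i)" "(\<Inter>i\<in>J. A i) \<subseteq> I"
  shows "\<exists>i\<in>J. A i \<subseteq> I"
  using assms(3-6)
proof (induction J rule: finite_ne_induct)
  case (insert j J)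
  have "k_ideal S (\<Inter>i\<in>J. A i)"
    using k_ideal_INT[OF assms(1) insert.hyps(2)] insert.prems(1) by blast
  then have "A j \<subseteq> I \<or> (\<Inter>i\<in>J. A i) \<subseteq> I"
    using I insert.prems by (simp add: k_strongly_irreducible_def)
  then show ?case
    using insert.IH insert.prems(1) by blast
qed simp

lemma laskerian_k_strongly_irreducible_imp_k_primary:
  assumes "semiring S" "laskerian S" "k_strongly_irreducible S I"
  shows "k_primary S I"
proof -
  have "k_ideal S I" using assms(3) by (simp add: k_strongly_irreducible_def)
  then obtain n :: nat and A where n: "n \<ge> 1" and A: "\<forall>i\<in>{1..n}. k_primary S (A i)"
    and eq: "I = (\<Inter>i\<in>{1..n}. A i)"
    using assms(2) unfolding laskerian_def by blast
  have "\<exists>i\<in>{1..n}. A i \<subseteq> I"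
    using n A eq
    by (intro k_strongly_irreducible_finite_INT[OF assms(1,3)]) (auto simp: k_primary_def)
  then obtain i where "i \<in> {1..n}" "A i \<subseteq> I" by blast
  \<comment> \<open>As the intersection of the whole family, \<open>I\<close> is also contained in
    \<open>A i\<close>.\<close>
  then have "I = A i" using eq by blast
  then show ?thesis using A \<open>i \<in> {1..n}\<close> by simp
qed

text \<open>Since \<open>b = b^2 x\<close>, every \<open>n \<ge> 1\<close> satisfies
  \<open>b^n = b^(n+1) x\<close>. Membership in \<open>I\<close> therefore descends from exponent
  \<open>n+1\<close> to \<open>n\<close>, and finally to 1.\<close>

lemma von_neumann_regular_power_mem:
  assumes "semiring S" "comm_monoid S" "von_neumann_regular S" "k_ideal S I"
    and b: "b \<in> carrier S" and "n \<ge> 1" "b [^]\<^bsub>S\<^esub> (n::nat) \<in> I"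
  shows "b \<in> I"
proof -
  interpret semiring S by fact
  obtain x where x: "x \<in> carrier S" "b = b [^]\<^bsub>S\<^esub> (2::nat) \<otimes>\<^bsub>S\<^esub> x"
    using assms(3) b by (auto simp: von_neumann_regular_def)
  show ?thesis
    using assms(6,7)
  proof (induction n rule: dec_induct)
    case base
    then show ?case using b by simp
  next
    case (step n)
    \<comment> \<open>Because \<open>n \<ge> 1\<close>, one factor \<open>b\<close> can be split off
      \<open>b^n\<close> and replaced by \<open>b^2 x\<close>.\<close>
    obtain m where m: "n = Suc m" using step.hyps(1) by (cases n) auto
    have "b [^]\<^bsub>S\<^esub> n = b [^]\<^bsub>S\<^esub> m \<otimes>\<^bsub>S\<^esub> (b [^]\<^bsub>S\<^esub> (2::nat) \<otimes>\<^bsub>S\<^esub> x)"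
      using x(2) by (simp add: m)
    also have "\<dots> = b [^]\<^bsub>S\<^esub> Suc n \<otimes>\<^bsub>S\<^esub> x"
      using b x(1) by (simp add: m numeral_2_eq_2 m_assoc)
    also have "\<dots> \<in> I"
      using k_ideal_mult_right[OF assms(2,4) x(1) step.prems] .
    finally show ?case by (rule step.IH)
  qed
qed

lemma von_neumann_regular_k_strongly_irreducible_imp_k_primary:
  assumes "semiring S" "comm_monoid S" "von_neumann_regular S" "k_strongly_irreducible S I"
  shows "k_primary S I"
  unfolding k_primary_def
proof (intro conjI ballI impI)
  interpret semiring S by fact
  show I: "k_ideal S I" using assms(4) by (simp add: k_strongly_irreducible_def)
  fix a b assume a: "a \<in> carrier S" and b: "b \<in> carrier S"
    and ab: "a \<otimes>\<^bsub>S\<^esub> b \<in> I \<and> a \<notin> I"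
  define A where "A = {y \<in> carrier S. \<forall>x\<in>{b}. y \<otimes>\<^bsub>S\<^esub> x \<in> I}"
  define B where "B = {y \<in> carrier S. \<forall>x\<in>A. y \<otimes>\<^bsub>S\<^esub> x \<in> I}"
  have A: "k_ideal S A"
    unfolding A_def using b by (intro k_ideal_residual[OF assms(1) I]) simp
  have B: "k_ideal S B"
    unfolding B_def by (intro k_ideal_residual[OF assms(1) I]) (auto simp: A_def)
  have "A \<inter> B \<subseteq> I"
  proof
    fix x assume x: "x \<in> A \<inter> B"
    \<comment> \<open>The condition defining \<open>B\<close> ranges over all elements of
      \<open>A\<close>, so it may be tested at \<open>x\<close> itself.\<close>
    then have "x \<in> carrier S" "x \<otimes>\<^bsub>S\<^esub> x \<in> I" by (auto simp: B_def)
    then show "x \<in> I"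
      using von_neumann_regular_power_mem[OF assms(1-3) I, of x 2] by (simp add: numeral_2_eq_2)
  qed
  then have "A \<subseteq> I \<or> B \<subseteq> I"
    using A B assms(4) by (simp add: k_strongly_irreducible_def)
  moreover have "a \<in> A" using a ab by (simp add: A_def)
  \<comment> \<open>By commutativity, \<open>b y = y b\<close>, which lies in \<open>I\<close> for
    each \<open>y\<close> in \<open>A\<close>.\<close>
  moreover have "b \<in> B"
    using b comm_monoid.m_comm[OF assms(2)] by (simp add: A_def B_def)
  \<comment> \<open>The element \<open>a\<close> of \<open>A\<close> lies outside \<open>I\<close>,
    so \<open>B \<subseteq> I\<close> must hold, and exponent 1 already works.\<close>
  ultimately have "b [^]\<^bsub>S\<^esub> (1::nat) \<in> I" using ab b by auto
  then show "\<exists>n::nat. n \<ge> 1 \<and> b [^]\<^bsub>S\<^esub> n \<in> I" by blast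
qed

lemma von_neumann_regular_k_primary_imp_k_strongly_irreducible:
  assumes "semiring S" "comm_monoid S" "von_neumann_regular S" "k_primary S I"
  shows "k_strongly_irreducible S I"
  unfolding k_strongly_irreducible_def
proof (intro conjI allI impI)
  show I: "k_ideal S I" using assms(4) by (simp add: k_primary_def)
  fix A B assume AB: "k_ideal S A \<and> k_ideal S B \<and> A \<inter> B \<subseteq> I"
  show "A \<subseteq> I \<or> B \<subseteq> I"
  proof (rule ccontr)
    assume "\<not> (A \<subseteq> I \<or> B \<subseteq> I)"
    then obtain a b where a: "a \<in> A" "a \<notin> I" and b: "b \<in> B" "b \<notin> I" by blast
    have carr: "a \<in> carrier S" "b \<in> carrier S"
      using a b AB k_ideal_subset_carrier by blast+
    \<comment> \<open>Absorption in \<open>A\<close> and in \<open>B\<close> puts the product in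
      both, hence in \<open>I\<close>; as \<open>a\<close> is outside \<open>I\<close>, primality up
      to powers applies to \<open>b\<close>.\<close>
    have "a \<otimes>\<^bsub>S\<^esub> b \<in> A \<inter> B"
      using k_ideal_mult_right[OF assms(2), of A b a] k_ideal_mult_left[of S B a b] AB a b carr
      by simp
    then obtain n :: nat where "n \<ge> 1" "b [^]\<^bsub>S\<^esub> n \<in> I"
      using AB assms(4) a carr unfolding k_primary_def by blast
    then have "b \<in> I"
      by (rule von_neumann_regular_power_mem[OF assms(1-3) I carr(2)])
    then show False using b by simp
  qed
qed

theorem proposition6p2:
  fixes S :: "('a, 'b) ring_scheme"
  assumes "semiring S" and "comm_monoid S"
  shows "(\<forall>I. k_strongly_irreducible S I \<longrightarrow> (k_prime S I \<longleftrightarrow> I = k_radical S I))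
    \<and> (laskerian S \<longrightarrow> (\<forall>I. k_strongly_irreducible S I \<longrightarrow> k_primary S I))
    \<and> (von_neumann_regular S \<longrightarrow>
         (\<forall>I. semiring_ideal S I \<longrightarrow> (k_strongly_irreducible S I \<longleftrightarrow> k_primary S I)))"
  using k_prime_imp_eq_k_radical[of S] k_prime_if_eq_k_radical[of S]
    laskerian_k_strongly_irreducible_imp_k_primary[OF assms(1)]
    von_neumann_regular_k_strongly_irreducible_imp_k_primary[OF assms]
    von_neumann_regular_k_primary_imp_k_strongly_irreducible[OF assms]
  by meson

end
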